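(* For any set $\varPhi\cup\{\varphi\}\subseteq Fm_\equiv$: $\ \varPhi\Vdash_{\mathit{SCI}}\varphi\ \Leftrightarrow\ \varPhi\vdash_{\mathit{SCI}}\varphi$.
   Context: Language: $Fm_\equiv$ is the set of formulas built from an infinite set $V=\{x_0,x_1,\dots\}$ of propositional variables, $\bot,\top$, and connectives $\neg,\vee,\wedge,\rightarrow,\equiv$. Logic $\mathit{SCI}$: axioms are all formulas having the form of a classical tautology (substitution instances of classical propositional tautologies) and all formulas of the forms $\varphi\equiv\varphi$; $(\varphi\equiv\psi)\rightarrow(\varphi\rightarrow\psi)$; $(\varphi\equiv\psi)\rightarrow(\neg\varphi\equiv\neg\psi)$; $((\varphi_1\equiv\psi_1)\wedge(\varphi_2\equiv\psi_2))\rightarrow((\varphi_1*\varphi_2)\equiv(\psi_1*\psi_2))$ for $*\in\{\vee,\wedge,\rightarrow,\equiv\}$. The only rule is Modus Ponens. $\varPhi\vdash_{\mathit{SCI}}\varphi$ means there is a derivation of $\varphi$ from $\varPhi$. Boolean prealgebras: A Boolean algebra is regarded as a structure $(B,f_\vee,f_\wedge,f_\neg,f_\bot,f_\top,f_\rightarrow)$ with $f_\rightarrow(a,b)=f_\vee(f_\neg(a),b)$. A structure $\mathcal{B}=(B,f_\vee,f_\wedge,f_\neg,f_\bot,f_\top,f_\rightarrow,\preceq)$ with operations of arities $(2,2,1,0,0,2)$ and a preorder $\preceq$ is a Boolean prealgebra if $a\approx b:\Leftrightarrow(a\preceq b$ and $b\preceq a)$ is a congruence relation, $\mathcal{B}/{\approx}$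 is a Boolean algebra, and for all $a,b$: $a\preceq b\Leftrightarrow f_\wedge(a,b)\approx a$. A subset $F\subseteq B$ closed under $\approx$ is an ultrafilter of $\mathcal{B}$ if $\{\overline{a}\mid a\in F\}$ is an ultrafilter of $\mathcal{B}/{\approx}$. An $\mathit{SCI}$-model is a structure $\mathcal{M}=(M,\mathit{TRUE},f_\vee,f_\wedge,f_\neg,f_\bot,f_\top,f_\rightarrow,f_\equiv,\preceq)$ where $(M,f_\vee,f_\wedge,f_\neg,f_\bot,f_\top,f_\rightarrow,\preceq)$ is a Boolean prealgebra, $\mathit{TRUE}\subseteq M$ is an ultrafilter of it, and $f_\equiv$ is a binary function with $f_\equiv(m,m')\in\mathit{TRUE}\Leftrightarrow m=m'$. An assignment $\gamma\colon V\to M$ extends to $Fm_\equiv$ by $\gamma(\bot)=f_\bot$, $\gamma(\top)=f_\top$, $\gamma(\neg\varphi)=f_\neg(\gamma(\varphi))$, $\gamma(\varphi*\psi)=f_*(\gamma(\varphi),\gamma(\psi))$ for $*\in\{\vee,\wedge,\rightarrow,\equiv\}$. Satisfaction: $(\mathcal{M},\gamma)\vDash\varphi:\Leftrightarrow\gamma(\varphi)\in\mathit{TRUE}$. $\varPhi\Vdash_{\mathit{SCI}}\varphi$ means: every pair $(\mathcal{M},\gamma)$ of an $\mathit{SCI}$-model and an assignment that satisfies all formulas of $\varPhi$ satisfies $\varphi$. *)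

theory Defs
  imports Main
begin

datatype fm =
    Var nat
  | Bot
  | Top
  | Neg fm
  | Or fm fm
  | And fm fm
  | Imp fm fm
  | Ident fm fm

text \<open>
  Classical propositional formulas are a separate datatype, so that ``having the form of a
  classical tautology'' is literally ``being a substitution instance of a tautology''.
\<close>

datatype cfm =
    CVar nat
  | CBot
  | CTop
  | CNeg cfm
  | COr cfm cfm
  | CAnd cfm cfm
  | CImp cfm cfm

primrec truth_value :: "(nat \<Rightarrow> bool) \<Rightarrow> cfm \<Rightarrow> bool" where
  "truth_value v (CVar n) = v n"
| "truth_value v CBot = False"
| "truth_value v CTop = True"
| "truth_value v (CNeg p) = (\<not> truth_value v p)"
| "truth_value v (COr p q) = (truth_value v p \<or> truth_value v q)"
| "truth_value v (CAnd p q) = (truth_value v p \<and> truth_value v q)"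
| "truth_value v (CImp p q) = (truth_value v p \<longrightarrow> truth_value v q)"

definition tautology :: "cfm \<Rightarrow> bool" where
  "tautology p \<longleftrightarrow> (\<forall>v. truth_value v p)"

primrec inst :: "(nat \<Rightarrow> fm) \<Rightarrow> cfm \<Rightarrow> fm" where
  "inst \<sigma> (CVar n) = \<sigma> n"
| "inst \<sigma> CBot = Bot"
| "inst \<sigma> CTop = Top"
| "inst \<sigma> (CNeg p) = Neg (inst \<sigma> p)"
| "inst \<sigma> (COr p q) = Or (inst \<sigma> p) (inst \<sigma> q)"
| "inst \<sigma> (CAnd p q) = And (inst \<sigma> p) (inst \<sigma> q)"
| "inst \<sigma> (CImp p q) = Imp (inst \<sigma> p) (inst \<sigma> q)"

inductive_set sci_axioms :: "fm set" where
  taut: "tautology p \<Longrightarrow> inst \<sigma> p \<in> sci_axioms"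
| ident_refl: "Ident \<phi> \<phi> \<in> sci_axioms"
| ident_imp: "Imp (Ident \<phi> \<psi>) (Imp \<phi> \<psi>) \<in> sci_axioms"
| ident_Neg: "Imp (Ident \<phi> \<psi>) (Ident (Neg \<phi>) (Neg \<psi>)) \<in> sci_axioms"
| ident_cong:
    "c \<in> {Or, And, Imp, Ident} \<Longrightarrow>
      Imp (And (Ident \<phi>1 \<psi>1) (Ident \<phi>2 \<psi>2)) (Ident (c \<phi>1 \<phi>2) (c \<psi>1 \<psi>2)) \<in> sci_axioms"

inductive sci_derives :: "fm set \<Rightarrow> fm \<Rightarrow> bool" (infix "\<turnstile>\<^sub>S\<^sub>C\<^sub>I" 50)
  for \<Phi> :: "fm set" where
  hyp: "\<phi> \<in> \<Phi> \<Longrightarrow> \<Phi> \<turnstile>\<^sub>S\<^sub>C\<^sub>I \<phi>"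
| ax: "\<phi> \<in> sci_axioms \<Longrightarrow> \<Phi> \<turnstile>\<^sub>S\<^sub>C\<^sub>I \<phi>"
| mp: "\<Phi> \<turnstile>\<^sub>S\<^sub>C\<^sub>I \<phi> \<Longrightarrow> \<Phi> \<turnstile>\<^sub>S\<^sub>C\<^sub>I Imp \<phi> \<psi> \<Longrightarrow> \<Phi> \<turnstile>\<^sub>S\<^sub>C\<^sub>I \<psi>"

record 'm boolean_struct =
  univ :: "'m set"
  f_or :: "'m \<Rightarrow> 'm \<Rightarrow> 'm"
  f_and :: "'m \<Rightarrow> 'm \<Rightarrow> 'm"
  f_neg :: "'m \<Rightarrow> 'm"
  f_bot :: 'm
  f_top :: 'm
  f_imp :: "'m \<Rightarrow> 'm \<Rightarrow> 'm"

record 'm ordered_struct = "'m boolean_struct" +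
  below :: "('m \<times> 'm) set"

record 'm sci_struct = "'m ordered_struct" +
  TRUE :: "'m set"
  f_ident :: "'m \<Rightarrow> 'm \<Rightarrow> 'm"

text \<open>
  Operations are total functions on the type \<open>'m\<close>; only their values on the universe matter,
  and the universe has to be closed under them.
\<close>

definition closed_ops :: "('m, 'x) boolean_struct_scheme \<Rightarrow> bool" where
  "closed_ops B \<longleftrightarrow>
     (\<forall>a\<in>univ B. \<forall>b\<in>univ B. f_or B a b \<in> univ B) \<and>
     (\<forall>a\<in>univ B. \<forall>b\<in>univ B. f_and B a b \<in> univ B) \<and>
     (\<forall>a\<in>univ B. f_neg B a \<in> univ B) \<and>
     f_bot B \<in> univ B \<and>
     f_top B \<in> univ B \<and>
     (\<forall>a\<in>univ B. \<forall>b\<in>univ B. f_imp B a b \<in> univ B)"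

definition is_boolean_algebra :: "('m, 'x) boolean_struct_scheme \<Rightarrow> bool" where
  "is_boolean_algebra B \<longleftrightarrow> closed_ops B \<and>
     (\<forall>a\<in>univ B. \<forall>b\<in>univ B. f_or B a b = f_or B b a) \<and>
     (\<forall>a\<in>univ B. \<forall>b\<in>univ B. f_and B a b = f_and B b a) \<and>
     (\<forall>a\<in>univ B. \<forall>b\<in>univ B. \<forall>c\<in>univ B. f_or B (f_or B a b) c = f_or B a (f_or B b c)) \<and>
     (\<forall>a\<in>univ B. \<forall>b\<in>univ B. \<forall>c\<in>univ B. f_and B (f_and B a b) c = f_and B a (f_and B b c)) \<and>
     (\<forall>a\<in>univ B. \<forall>b\<in>univ B. f_or B a (f_and B a b) = a) \<and>
     (\<forall>a\<in>univ B. \<forall>b\<in>univ B. f_and B a (f_or B a b) = a) \<and>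
     (\<forall>a\<in>univ B. \<forall>b\<in>univ B. \<forall>c\<in>univ B.
        f_or B a (f_and B b c) = f_and B (f_or B a b) (f_or B a c)) \<and>
     (\<forall>a\<in>univ B. \<forall>b\<in>univ B. \<forall>c\<in>univ B.
        f_and B a (f_or B b c) = f_or B (f_and B a b) (f_and B a c)) \<and>
     (\<forall>a\<in>univ B. f_or B a (f_bot B) = a) \<and>
     (\<forall>a\<in>univ B. f_and B a (f_top B) = a) \<and>
     (\<forall>a\<in>univ B. f_or B a (f_neg B a) = f_top B) \<and>
     (\<forall>a\<in>univ B. f_and B a (f_neg B a) = f_bot B) \<and>
     (\<forall>a\<in>univ B. \<forall>b\<in>univ B. f_imp B a b = f_or B (f_neg B a) b)"

text \<open>
  The order of a Boolean algebra is \<open>a \<le> b \<longleftrightarrow> a \<and> b = a\<close>; an ultrafilter is a maximal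
  proper filter.
\<close>

definition is_proper_filter :: "('m, 'x) boolean_struct_scheme \<Rightarrow> 'm set \<Rightarrow> bool" where
  "is_proper_filter B F \<longleftrightarrow>
     F \<subseteq> univ B \<and>
     f_top B \<in> F \<and>
     f_bot B \<notin> F \<and>
     (\<forall>a\<in>F. \<forall>b\<in>F. f_and B a b \<in> F) \<and>
     (\<forall>a\<in>F. \<forall>b\<in>univ B. f_and B a b = a \<longrightarrow> b \<in> F)"

definition is_ultrafilter :: "('m, 'x) boolean_struct_scheme \<Rightarrow> 'm set \<Rightarrow> bool" where
  "is_ultrafilter B F \<longleftrightarrow>
     is_proper_filter B F \<and> (\<forall>G. is_proper_filter B G \<and> F \<subseteq> G \<longrightarrow> G = F)"

definition pre_equiv :: "('m, 'x) ordered_struct_scheme \<Rightarrow> ('m \<times> 'm) set" where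
  "pre_equiv B = {(a, b). a \<in> univ B \<and> b \<in> univ B \<and> (a, b) \<in> below B \<and> (b, a) \<in> below B}"

definition is_congruence ::
  "('m, 'x) boolean_struct_scheme \<Rightarrow> ('m \<times> 'm) set \<Rightarrow> bool" where
  "is_congruence B r \<longleftrightarrow>
     equiv (univ B) r \<and>
     (\<forall>(a, a')\<in>r. (f_neg B a, f_neg B a') \<in> r) \<and>
     (\<forall>f\<in>{f_or B, f_and B, f_imp B}. \<forall>(a, a')\<in>r. \<forall>(b, b')\<in>r. (f a b, f a' b') \<in> r)"

text \<open>
  The quotient operations send classes to the class of the result on representatives, expressed
  by a union over all representatives, which is independent of the choice for a congruence.
\<close>

definition quotient_struct ::
  "('m, 'x) boolean_struct_scheme \<Rightarrow> ('m \<times> 'm) set \<Rightarrow> 'm set boolean_struct" where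
  "quotient_struct B r =
     \<lparr> univ = univ B // r,
       f_or = (\<lambda>X Y. \<Union>a\<in>X. \<Union>b\<in>Y. r `` {f_or B a b}),
       f_and = (\<lambda>X Y. \<Union>a\<in>X. \<Union>b\<in>Y. r `` {f_and B a b}),
       f_neg = (\<lambda>X. \<Union>a\<in>X. r `` {f_neg B a}),
       f_bot = r `` {f_bot B},
       f_top = r `` {f_top B},
       f_imp = (\<lambda>X Y. \<Union>a\<in>X. \<Union>b\<in>Y. r `` {f_imp B a b}) \<rparr>"

definition is_boolean_prealgebra :: "('m, 'x) ordered_struct_scheme \<Rightarrow> bool" where
  "is_boolean_prealgebra B \<longleftrightarrow>
     closed_ops B \<and>
     preorder_on (univ B) (below B) \<and>
     is_congruence B (pre_equiv B) \<and>
     is_boolean_algebra (quotient_struct B (pre_equiv B)) \<and>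
     (\<forall>a\<in>univ B. \<forall>b\<in>univ B. (a, b) \<in> below B \<longleftrightarrow> (f_and B a b, a) \<in> pre_equiv B)"

definition is_pre_ultrafilter :: "('m, 'x) ordered_struct_scheme \<Rightarrow> 'm set \<Rightarrow> bool" where
  "is_pre_ultrafilter B F \<longleftrightarrow>
     F \<subseteq> univ B \<and>
     (\<forall>(a, b)\<in>pre_equiv B. a \<in> F \<longrightarrow> b \<in> F) \<and>
     is_ultrafilter (quotient_struct B (pre_equiv B)) ((\<lambda>a. pre_equiv B `` {a}) ` F)"

definition is_sci_model :: "'m sci_struct \<Rightarrow> bool" where
  "is_sci_model M \<longleftrightarrow>
     is_boolean_prealgebra M \<and>
     is_pre_ultrafilter M (TRUE M) \<and>
     (\<forall>a\<in>univ M. \<forall>b\<in>univ M. f_ident M a b \<in> univ M) \<and>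
     (\<forall>a\<in>univ M. \<forall>b\<in>univ M. f_ident M a b \<in> TRUE M \<longleftrightarrow> a = b)"

definition assignment :: "'m sci_struct \<Rightarrow> (nat \<Rightarrow> 'm) \<Rightarrow> bool" where
  "assignment M \<gamma> \<longleftrightarrow> (\<forall>n. \<gamma> n \<in> univ M)"

primrec interp :: "'m sci_struct \<Rightarrow> (nat \<Rightarrow> 'm) \<Rightarrow> fm \<Rightarrow> 'm" where
  "interp M \<gamma> (Var n) = \<gamma> n"
| "interp M \<gamma> Bot = f_bot M"
| "interp M \<gamma> Top = f_top M"
| "interp M \<gamma> (Neg \<phi>) = f_neg M (interp M \<gamma> \<phi>)"
| "interp M \<gamma> (Or \<phi> \<psi>) = f_or M (interp M \<gamma> \<phi>) (interp M \<gamma> \<psi>)"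
| "interp M \<gamma> (And \<phi> \<psi>) = f_and M (interp M \<gamma> \<phi>) (interp M \<gamma> \<psi>)"
| "interp M \<gamma> (Imp \<phi> \<psi>) = f_imp M (interp M \<gamma> \<phi>) (interp M \<gamma> \<psi>)"
| "interp M \<gamma> (Ident \<phi> \<psi>) = f_ident M (interp M \<gamma> \<phi>) (interp M \<gamma> \<psi>)"

definition satisfies :: "'m sci_struct \<Rightarrow> (nat \<Rightarrow> 'm) \<Rightarrow> fm \<Rightarrow> bool" where
  "satisfies M \<gamma> \<phi> \<longleftrightarrow> interp M \<gamma> \<phi> \<in> TRUE M"

text \<open>
  HOL cannot quantify over all types inside a formula, so the consequence relation takes the type
  \<open>'m\<close> from which universes are drawn as a parameter; the universe of a model is an arbitrary
  subset of \<open>'m\<close>.  A finite \<open>'m\<close> would exclude the infinite models, hence give a different relation;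
  the intended reading is for infinite \<open>'m\<close>, finite universes being included as subsets.
\<close>

definition sci_entails :: "'m itself \<Rightarrow> fm set \<Rightarrow> fm \<Rightarrow> bool" where
  "sci_entails T \<Phi> \<phi> \<longleftrightarrow>
     (\<forall>(M :: 'm sci_struct) \<gamma>.
        is_sci_model M \<and> assignment M \<gamma> \<and> (\<forall>\<psi>\<in>\<Phi>. satisfies M \<gamma> \<psi>) \<longrightarrow> satisfies M \<gamma> \<phi>)"

end

theory Submission
  imports Defs "HOL-Library.Countable"
begin

text \<open>
  Soundness holds because membership in \<open>TRUE\<close> commutes with the classical connectives, as the
  image of \<open>TRUE\<close> in the quotient algebra is an ultrafilter.

  For completeness, a set not deriving \<open>\<phi>\<close> is extended to a maximal such set \<open>\<Gamma>\<close>, and formulas are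
  identified when their identity belongs to \<open>\<Gamma>\<close>. There are only countably many formulas, so the
  classes embed into any infinite type. As preorder on this quotient take
  \<open>a \<preceq> b \<longleftrightarrow> (a \<in> \<Gamma> \<longrightarrow> b \<in> \<Gamma>)\<close>: nothing in the definition of a model forces it to be finer, and the
  associated Boolean algebra is then just the two-element one.
\<close>

text \<open>As far as the classical connectives go, membership in \<open>T\<close> is a homomorphism
  onto the truth values. No Boolean law is assumed of \<open>B\<close>, so ultrafilters of algebras
  and of prealgebras as well as the canonical model fit this pattern.\<close>

locale two_valued =
  fixes B :: "('m, 'x) boolean_struct_scheme" and T :: "'m set"
  assumes closed: "closed_ops B"
    and T_subset: "T \<subseteq> univ B"
    and T_bot: "f_bot B \<notin> T"
    and T_top: "f_top B \<in> T"
    and T_neg: "a \<in> univ B \<Longrightarrow> f_neg B a \<in> T \<longleftrightarrow> a \<notin> T"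
    and T_or: "a \<in> univ B \<Longrightarrow> b \<in> univ B \<Longrightarrow> f_or B a b \<in> T \<longleftrightarrow> a \<in> T \<or> b \<in> T"
    and T_and: "a \<in> univ B \<Longrightarrow> b \<in> univ B \<Longrightarrow> f_and B a b \<in> T \<longleftrightarrow> a \<in> T \<and> b \<in> T"
    and T_imp: "a \<in> univ B \<Longrightarrow> b \<in> univ B \<Longrightarrow> f_imp B a b \<in> T \<longleftrightarrow> (a \<in> T \<longrightarrow> b \<in> T)"
begin

lemmas T_simps = T_bot T_top T_neg T_or T_and T_imp

lemma ops_closed [simp]:
  "f_bot B \<in> univ B" "f_top B \<in> univ B"
  "a \<in> univ B \<Longrightarrow> f_neg B a \<in> univ B"
  "a \<in> univ B \<Longrightarrow> b \<in> univ B \<Longrightarrow> f_or B a b \<in> univ B"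
  "a \<in> univ B \<Longrightarrow> b \<in> univ B \<Longrightarrow> f_and B a b \<in> univ B"
  "a \<in> univ B \<Longrightarrow> b \<in> univ B \<Longrightarrow> f_imp B a b \<in> univ B"
  using closed by (auto simp: closed_ops_def)

end

section \<open>Ultrafilters and quotients\<close>

text \<open>Maximality enters through negation: if \<open>a \<notin> F\<close>, the filter generated
  by \<open>F\<close> and \<open>a\<close> is improper, which forces an element of \<open>F\<close>
  below the complement of \<open>a\<close>. Disjunction follows from negation by distributivity, and
  implication reduces to these two.\<close>

lemma ultrafilter_two_valued:
  assumes alg: "is_boolean_algebra B" and uf: "is_ultrafilter B F"
  shows "two_valued B F"
proof -
  have cl: "closed_ops B" using alg by (simp add: is_boolean_algebra_def)
  have C [simp]: "f_bot B \<in> univ B" "f_top B \<in> univ B"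
    "\<And>a. a \<in> univ B \<Longrightarrow> f_neg B a \<in> univ B"
    "\<And>a b. a \<in> univ B \<Longrightarrow> b \<in> univ B \<Longrightarrow> f_or B a b \<in> univ B"
    "\<And>a b. a \<in> univ B \<Longrightarrow> b \<in> univ B \<Longrightarrow> f_and B a b \<in> univ B"
    "\<And>a b. a \<in> univ B \<Longrightarrow> b \<in> univ B \<Longrightarrow> f_imp B a b \<in> univ B"
    using cl by (auto simp: closed_ops_def)
  have or_comm: "f_or B a b = f_or B b a" if "a \<in> univ B" "b \<in> univ B" for a b
    using alg that unfolding is_boolean_algebra_def by meson
  have and_comm: "f_and B a b = f_and B b a" if "a \<in> univ B" "b \<in> univ B" for a b
    using alg that unfolding is_boolean_algebra_def by meson
  have and_assoc: "f_and B (f_and B a b) c = f_and B a (f_and B b c)"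
    if "a \<in> univ B" "b \<in> univ B" "c \<in> univ B" for a b c
    using alg that unfolding is_boolean_algebra_def by meson
  have absorb1: "f_or B a (f_and B a b) = a" if "a \<in> univ B" "b \<in> univ B" for a b
    using alg that unfolding is_boolean_algebra_def by meson
  have absorb2: "f_and B a (f_or B a b) = a" if "a \<in> univ B" "b \<in> univ B" for a b
    using alg that unfolding is_boolean_algebra_def by meson
  have distrib: "f_and B a (f_or B b c) = f_or B (f_and B a b) (f_and B a c)"
    if "a \<in> univ B" "b \<in> univ B" "c \<in> univ B" for a b c
    using alg that unfolding is_boolean_algebra_def by meson
  have or_bot: "f_or B a (f_bot B) = a" if "a \<in> univ B" for a
    using alg that unfolding is_boolean_algebra_def by meson
  have and_top: "f_and B a (f_top B) = a" if "a \<in> univ B" for a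
    using alg that unfolding is_boolean_algebra_def by meson
  have or_neg: "f_or B a (f_neg B a) = f_top B" if "a \<in> univ B" for a
    using alg that unfolding is_boolean_algebra_def by meson
  have and_neg: "f_and B a (f_neg B a) = f_bot B" if "a \<in> univ B" for a
    using alg that unfolding is_boolean_algebra_def by meson
  have imp_eq: "f_imp B a b = f_or B (f_neg B a) b" if "a \<in> univ B" "b \<in> univ B" for a b
    using alg that unfolding is_boolean_algebra_def by meson
  have and_idem: "f_and B a a = a" if "a \<in> univ B" for a
    using absorb2[of a "f_bot B"] or_bot[of a] that by simp
  have and_bot: "f_and B a (f_bot B) = f_bot B" if "a \<in> univ B" for a
    by (metis C(1,5) that absorb1 and_comm or_bot or_comm)

  have pf: "is_proper_filter B F" using uf by (simp add: is_ultrafilter_def)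
  then have F: "F \<subseteq> univ B" and top: "f_top B \<in> F" and bot: "f_bot B \<notin> F"
    and meet: "\<And>a b. a \<in> F \<Longrightarrow> b \<in> F \<Longrightarrow> f_and B a b \<in> F"
    and up: "\<And>a b. a \<in> F \<Longrightarrow> b \<in> univ B \<Longrightarrow> f_and B a b = a \<Longrightarrow> b \<in> F"
    by (auto simp: is_proper_filter_def)
  have and_left: "f_and B a b \<in> F \<Longrightarrow> a \<in> F" if "a \<in> univ B" "b \<in> univ B" for a b
    using up[of "f_and B a b" a] that by (metis C(5) and_assoc and_comm and_idem)
  have and_right: "f_and B a b \<in> F \<Longrightarrow> b \<in> F" if "a \<in> univ B" "b \<in> univ B" for a b
    using and_left that by (metis and_comm)
  have or_left: "a \<in> F \<Longrightarrow> f_or B a b \<in> F" if "a \<in> univ B" "b \<in> univ B" for a b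
    using up that absorb2 by simp
  have neg: "f_neg B a \<in> F \<longleftrightarrow> a \<notin> F" if a: "a \<in> univ B" for a
  proof
    show "f_neg B a \<in> F \<Longrightarrow> a \<notin> F"
      using meet bot and_neg a by fastforce
  next
    assume "a \<notin> F"
    \<comment> \<open>The filter generated by \<open>F\<close> and \<open>a\<close>: everything
      above the meet of \<open>a\<close> with some \<open>f \<in> F\<close>, the order being read
      off from meets.\<close>
    define G where "G = {b \<in> univ B. \<exists>f\<in>F. f_and B (f_and B f a) b = f_and B f a}"
    have "F \<subseteq> G"
    proof
      fix b assume b: "b \<in> F"
      then have "f_and B (f_and B b a) b = f_and B b a"
        using F a by (metis C(5) and_assoc and_comm and_idem subsetD)
      then show "b \<in> G" using b F by (auto simp: G_def)
    qed
    have "a \<in> G"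
      using a top and_idem and_comm and_top by (auto simp: G_def intro!: bexI[of _ "f_top B"])
    have "G \<noteq> F" using \<open>a \<in> G\<close> \<open>a \<notin> F\<close> by blast
    \<comment> \<open>All filter conditions other than properness are verified for \<open>G\<close>,
      so the one that fails must be \<open>f_bot B \<notin> G\<close>.\<close>
    then have "\<not> is_proper_filter B G"
      using uf \<open>F \<subseteq> G\<close> by (auto simp: is_ultrafilter_def)
    moreover have "f_and B b c \<in> G" if bc: "b \<in> G" "c \<in> G" for b c
    proof -
      obtain f g where fg: "f \<in> F" "g \<in> F" and
        f: "f_and B (f_and B f a) b = f_and B f a" and
        g: "f_and B (f_and B g a) c = f_and B g a" and u: "b \<in> univ B" "c \<in> univ B"
        using bc by (auto simp: G_def)
      have fgu: "f \<in> univ B" "g \<in> univ B" using fg F by auto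
      \<comment> \<open>The meet of the two witnesses lies below both and so serves \<open>b\<close>
        and \<open>c\<close> at once.\<close>
      let ?h = "f_and B f g"
      have h1: "f_and B ?h a = f_and B g (f_and B f a)"
        using fgu a by (metis C(5) and_assoc and_comm)
      have h2: "f_and B ?h a = f_and B f (f_and B g a)"
        using fgu a by (metis C(5) and_assoc and_comm)
      have "f_and B (f_and B ?h a) b = f_and B ?h a"
        unfolding h1 using f fgu a u by (simp add: and_assoc)
      moreover have "f_and B (f_and B ?h a) c = f_and B ?h a"
        unfolding h2 using g fgu a u by (simp add: and_assoc)
      ultimately have "f_and B (f_and B ?h a) (f_and B b c) = f_and B ?h a"
        using fgu a u by (metis C(5) and_assoc)
      then show ?thesis using u meet[OF fg] by (auto simp: G_def)
    qed
    moreover have "c \<in> G" if bc: "b \<in> G" "c \<in> univ B" "f_and B b c = b" for b c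
    proof -
      obtain f where f: "f \<in> F" "f_and B (f_and B f a) b = f_and B f a" and u: "b \<in> univ B"
        using bc by (auto simp: G_def)
      have "f_and B (f_and B f a) c = f_and B f a"
        using f bc(2,3) u a F by (metis C(5) and_assoc subsetD)
      then show ?thesis using f bc by (auto simp: G_def)
    qed
    moreover have "G \<subseteq> univ B" by (auto simp: G_def)
    ultimately have "f_bot B \<in> G"
      using \<open>F \<subseteq> G\<close> top unfolding is_proper_filter_def by blast
    then obtain f where f: "f \<in> F" "f_and B f a = f_bot B"
      using and_bot a F by (auto simp: G_def subset_iff)
    \<comment> \<open>\<open>f\<close> is the join of its meets with \<open>a\<close> and with the
      complement of \<open>a\<close>; the first of these is bottom.\<close>
    have "f_and B f (f_neg B a) = f"
      using distrib[of f a "f_neg B a"] f a F or_neg and_top or_bot or_comm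
      by (metis C(1,3,5) subsetD)
    then show "f_neg B a \<in> F" using up f a by simp
  qed
  have or: "f_or B a b \<in> F \<longleftrightarrow> a \<in> F \<or> b \<in> F" if ab: "a \<in> univ B" "b \<in> univ B" for a b
  proof
    assume *: "f_or B a b \<in> F"
    have "b \<in> F" if "a \<notin> F"
    proof -
      have "f_neg B a \<in> F" using that neg ab by simp
      \<comment> \<open>Disjunctive syllogism: after distributing, the part coming from
        \<open>a\<close> is bottom.\<close>
      then have "f_and B (f_neg B a) (f_or B a b) \<in> F" using meet * by simp
      also have "f_and B (f_neg B a) (f_or B a b) = f_and B (f_neg B a) b"
        using ab distrib[of "f_neg B a" a b] and_neg and_comm or_bot or_comm
        by (metis C(1,3,5))
      finally show "b \<in> F" by (rule and_right[rotated 2]) (simp_all add: ab)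
    qed
    then show "a \<in> F \<or> b \<in> F" by blast
  qed (use or_left or_comm ab in metis)
  show ?thesis
  proof
    show "f_and B a b \<in> F \<longleftrightarrow> a \<in> F \<and> b \<in> F" if "a \<in> univ B" "b \<in> univ B" for a b
      using that and_left and_right meet by blast
    show "f_imp B a b \<in> F \<longleftrightarrow> (a \<in> F \<longrightarrow> b \<in> F)" if "a \<in> univ B" "b \<in> univ B" for a b
      using that imp_eq or neg by simp
  qed (use cl F top bot neg or in auto)
qed

section \<open>Passing between a structure and its quotient\<close>

lemma equiv_UN_eq:
  assumes "equiv A r" "a \<in> A" "\<And>x. (a, x) \<in> r \<Longrightarrow> f x = f a"
  shows "(\<Union>x\<in>r `` {a}. f x) = f a"
proof -
  have "a \<in> r `` {a}" using assms(1,2) by (rule equiv_class_self)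
  moreover have "f x = f a" if "x \<in> r `` {a}" for x using assms(3) that by simp
  ultimately show ?thesis by (metis (no_types, lifting) SUP_eq_const empty_iff)
qed

text \<open>The unions in \<open>quotient_struct\<close> collapse: by congruence every choice of
  representatives contributes the same class, and classes are nonempty. From here on the quotient is
  computed on representatives.\<close>

lemma quotient_simps:
  assumes cong: "is_congruence B r"
  shows "univ (quotient_struct B r) = univ B // r"
    and "f_bot (quotient_struct B r) = r `` {f_bot B}"
    and "f_top (quotient_struct B r) = r `` {f_top B}"
    and "a \<in> univ B \<Longrightarrow> f_neg (quotient_struct B r) (r `` {a}) = r `` {f_neg B a}"
    and "a \<in> univ B \<Longrightarrow> b \<in> univ B \<Longrightarrow>
      f_or (quotient_struct B r) (r `` {a}) (r `` {b}) = r `` {f_or B a b}"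
    and "a \<in> univ B \<Longrightarrow> b \<in> univ B \<Longrightarrow>
      f_and (quotient_struct B r) (r `` {a}) (r `` {b}) = r `` {f_and B a b}"
    and "a \<in> univ B \<Longrightarrow> b \<in> univ B \<Longrightarrow>
      f_imp (quotient_struct B r) (r `` {a}) (r `` {b}) = r `` {f_imp B a b}"
proof -
  have eq: "equiv (univ B) r" using cong by (simp add: is_congruence_def)
  have bin: "(\<Union>x\<in>r `` {a}. \<Union>y\<in>r `` {b}. r `` {f x y}) = r `` {f a b}"
    if ab: "a \<in> univ B" "b \<in> univ B" and f: "f \<in> {f_or B, f_and B, f_imp B}" for f a b
  proof -
    have rel: "(f x y, f a b) \<in> r" if "(a, x) \<in> r" "(b, y) \<in> r" for x y
      using cong that f eq unfolding is_congruence_def by (blast dest: equivE symD)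
    have "(\<Union>x\<in>r `` {a}. \<Union>y\<in>r `` {b}. r `` {f x y}) = (\<Union>x\<in>r `` {a}. \<Union>y\<in>r `` {b}. r `` {f a b})"
      using equiv_class_eq[OF eq rel] by auto
    also have "\<dots> = r `` {f a b}"
      using equiv_class_self[OF eq ab(1)] equiv_class_self[OF eq ab(2)] by blast
    finally show ?thesis .
  qed
  have un: "(\<Union>x\<in>r `` {a}. r `` {f_neg B x}) = r `` {f_neg B a}" if a: "a \<in> univ B" for a
  proof (rule equiv_UN_eq[OF eq a])
    fix x assume "(a, x) \<in> r"
    then have "(f_neg B a, f_neg B x) \<in> r"
      using cong unfolding is_congruence_def by blast
    then show "r `` {f_neg B x} = r `` {f_neg B a}"
      using equiv_class_eq[OF eq] by simp
  qed
  show "univ (quotient_struct B r) = univ B // r"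
    "f_bot (quotient_struct B r) = r `` {f_bot B}"
    "f_top (quotient_struct B r) = r `` {f_top B}"
    "a \<in> univ B \<Longrightarrow> f_neg (quotient_struct B r) (r `` {a}) = r `` {f_neg B a}"
    "a \<in> univ B \<Longrightarrow> b \<in> univ B \<Longrightarrow>
      f_or (quotient_struct B r) (r `` {a}) (r `` {b}) = r `` {f_or B a b}"
    "a \<in> univ B \<Longrightarrow> b \<in> univ B \<Longrightarrow>
      f_and (quotient_struct B r) (r `` {a}) (r `` {b}) = r `` {f_and B a b}"
    "a \<in> univ B \<Longrightarrow> b \<in> univ B \<Longrightarrow>
      f_imp (quotient_struct B r) (r `` {a}) (r `` {b}) = r `` {f_imp B a b}"
    by (simp_all add: quotient_struct_def bin un)
qed

text \<open>The result for Boolean algebras, applied to the quotient, is pulled back along the class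
  map.\<close>

lemma pre_ultrafilter_two_valued:
  fixes B :: "('m, 'x) ordered_struct_scheme"
  assumes pre: "is_boolean_prealgebra B" and uf: "is_pre_ultrafilter B F"
  shows "two_valued B F"
proof -
  let ?r = "pre_equiv B"
  let ?cl = "\<lambda>a. ?r `` {a}"
  let ?Q = "quotient_struct B ?r"
  have cong: "is_congruence B ?r" and closed: "closed_ops B"
    using pre by (simp_all add: is_boolean_prealgebra_def)
  have eq: "equiv (univ B) ?r" using cong by (simp add: is_congruence_def)
  interpret Q: two_valued ?Q "?cl ` F"
    using pre uf ultrafilter_two_valued
    by (auto simp: is_boolean_prealgebra_def is_pre_ultrafilter_def)
  have F: "F \<subseteq> univ B" using uf by (simp add: is_pre_ultrafilter_def)
  \<comment> \<open>Closure under \<open>pre_equiv B\<close> makes \<open>F\<close> a union of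
    classes, so it can be recovered from its image.\<close>
  have mem: "?cl a \<in> ?cl ` F \<longleftrightarrow> a \<in> F" if a: "a \<in> univ B" for a
  proof
    assume "?cl a \<in> ?cl ` F"
    then obtain b where "b \<in> F" "?cl a = ?cl b" by blast
    then have "(b, a) \<in> ?r" using eq a F by (metis eq_equiv_class)
    then show "a \<in> F" using uf \<open>b \<in> F\<close> unfolding is_pre_ultrafilter_def by blast
  qed simp
  have cl: "?cl a \<in> univ ?Q" if "a \<in> univ B" for a
    using that by (simp add: quotient_simps(1)[OF cong] quotientI)
  have ops: "f_bot B \<in> univ B" "f_top B \<in> univ B"
    "\<And>a. a \<in> univ B \<Longrightarrow> f_neg B a \<in> univ B"
    "\<And>a b. a \<in> univ B \<Longrightarrow> b \<in> univ B \<Longrightarrow> f_or B a b \<in> univ B"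
    "\<And>a b. a \<in> univ B \<Longrightarrow> b \<in> univ B \<Longrightarrow> f_and B a b \<in> univ B"
    "\<And>a b. a \<in> univ B \<Longrightarrow> b \<in> univ B \<Longrightarrow> f_imp B a b \<in> univ B"
    using closed by (auto simp: closed_ops_def)
  note q = quotient_simps[OF cong]
  show ?thesis
  proof
    show "closed_ops B" "F \<subseteq> univ B" by fact+
    show "f_bot B \<notin> F" using Q.T_bot mem ops q(2) by metis
    show "f_top B \<in> F" using Q.T_top mem ops q(3) by metis
    fix a assume a: "a \<in> univ B"
    show "f_neg B a \<in> F \<longleftrightarrow> a \<notin> F" using Q.T_neg[OF cl[OF a]] mem ops q(4) a by metis
    fix b assume b: "b \<in> univ B"
    note ab = cl[OF a] cl[OF b]
    show "f_or B a b \<in> F \<longleftrightarrow> a \<in> F \<or> b \<in> F" using Q.T_or[OF ab] mem ops q(5) a b by metis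
    show "f_and B a b \<in> F \<longleftrightarrow> a \<in> F \<and> b \<in> F" using Q.T_and[OF ab] mem ops q(6) a b by metis
    show "f_imp B a b \<in> F \<longleftrightarrow> (a \<in> F \<longrightarrow> b \<in> F)" using Q.T_imp[OF ab] mem ops q(7) a b by metis
  qed
qed

text \<open>For this preorder, equivalence is agreement about membership in \<open>T\<close>. The
  quotient has just two classes, and each Boolean law becomes a propositional truth about membership
  in \<open>T\<close>.\<close>

lemma two_valued_pre_ultrafilter:
  fixes B :: "('m, 'x) ordered_struct_scheme"
  assumes "two_valued B T"
    and below: "below B = {(a, b). a \<in> univ B \<and> b \<in> univ B \<and> (a \<in> T \<longrightarrow> b \<in> T)}"
  shows "is_boolean_prealgebra B" and "is_pre_ultrafilter B T"
proof -
  interpret two_valued B T by fact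
  let ?r = "pre_equiv B"
  let ?cl = "\<lambda>a. ?r `` {a}"
  let ?Q = "quotient_struct B ?r"
  have r: "?r = {(a, b). a \<in> univ B \<and> b \<in> univ B \<and> (a \<in> T \<longleftrightarrow> b \<in> T)}"
    by (auto simp: pre_equiv_def below)
  have eq: "equiv (univ B) ?r"
    by (auto simp: r equiv_def refl_on_def sym_def trans_def)
  have cong: "is_congruence B ?r"
    using eq by (auto simp: is_congruence_def r T_simps)
  note q = quotient_simps[OF cong]
  have cl_eq: "?cl a = ?cl b \<longleftrightarrow> (a \<in> T \<longleftrightarrow> b \<in> T)" if "a \<in> univ B" "b \<in> univ B" for a b
    using that by (auto simp: r)
  have ball: "(\<forall>X\<in>univ ?Q. P X) \<longleftrightarrow> (\<forall>a\<in>univ B. P (?cl a))" for P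
    by (auto simp: q(1) quotient_def)
  have cl_in: "?cl a \<in> univ ?Q" if "a \<in> univ B" for a
    using that by (simp add: q(1) quotientI)
  have "closed_ops ?Q"
    by (simp add: closed_ops_def ball q(2-) cl_in)
  then have "is_boolean_algebra ?Q"
    unfolding is_boolean_algebra_def ball
    by (auto simp add: q(2-) cl_eq T_simps)
  moreover have "preorder_on (univ B) (below B)"
    by (auto simp: preorder_on_def below refl_on_def trans_def)
  ultimately show "is_boolean_prealgebra B"
    using closed cong by (auto simp: is_boolean_prealgebra_def r below T_simps)

  have mem: "?cl a \<in> ?cl ` T \<longleftrightarrow> a \<in> T" if "a \<in> univ B" for a
    using that T_subset cl_eq by blast
  have "is_proper_filter ?Q (?cl ` T)"
    unfolding is_proper_filter_def
  proof (intro conjI)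
    show "?cl ` T \<subseteq> univ ?Q" using T_subset cl_in by blast
    show "\<forall>X\<in>?cl ` T. \<forall>Y\<in>?cl ` T. f_and ?Q X Y \<in> ?cl ` T"
      using T_subset by (auto simp: q(2-) subset_iff mem T_simps)
    show "\<forall>X\<in>?cl ` T. \<forall>Y\<in>univ ?Q. f_and ?Q X Y = X \<longrightarrow> Y \<in> ?cl ` T"
      using T_subset unfolding ball by (auto simp: q(2-) subset_iff cl_eq mem T_simps)
  qed (simp_all add: q(2-) mem T_simps)
  moreover have "G = ?cl ` T" if G: "is_proper_filter ?Q G" "?cl ` T \<subseteq> G" for G
  proof -
    have "X \<in> ?cl ` T" if X: "X \<in> G" for X
    proof -
      have "X \<in> univ ?Q" using G(1) X by (auto simp: is_proper_filter_def)
      then obtain a where a: "a \<in> univ B" "X = ?cl a" by (auto simp: q(1) quotient_def)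
      \<comment> \<open>Outside the image of \<open>T\<close> there is only the class of bottom,
        which a proper filter omits.\<close>
      have "?cl a \<noteq> ?cl (f_bot B)"
        using G(1) X a by (auto simp: is_proper_filter_def q(2))
      then show ?thesis using a mem cl_eq T_bot by auto
    qed
    then show ?thesis using G(2) by blast
  qed
  ultimately show "is_pre_ultrafilter B T"
    unfolding is_pre_ultrafilter_def is_ultrafilter_def using T_subset by (auto simp: r)
qed

section \<open>Soundness\<close>

lemma interp_in_univ:
  assumes "is_sci_model M" "assignment M \<gamma>"
  shows "interp M \<gamma> \<phi> \<in> univ M"
  using assms
  by (induction \<phi>)
    (auto simp: assignment_def is_sci_model_def is_boolean_prealgebra_def closed_ops_def)

text \<open>An identity is true exactly when both sides have the same value, so the identity axioms
  amount to replacing equals by equals.\<close>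

lemma sci_axioms_sound:
  assumes M: "is_sci_model M" and \<gamma>: "assignment M \<gamma>" and "\<phi> \<in> sci_axioms"
  shows "satisfies M \<gamma> \<phi>"
proof -
  interpret two_valued M "TRUE M"
    using M pre_ultrafilter_two_valued by (auto simp: is_sci_model_def)
  note [simp] = interp_in_univ[OF M \<gamma>]
  have id_univ [simp]: "f_ident M a b \<in> univ M" if "a \<in> univ M" "b \<in> univ M" for a b
    using M that by (auto simp: is_sci_model_def)
  have id_TRUE [simp]: "f_ident M a b \<in> TRUE M \<longleftrightarrow> a = b" if "a \<in> univ M" "b \<in> univ M" for a b
    using M that by (auto simp: is_sci_model_def)
  from \<open>\<phi> \<in> sci_axioms\<close> show ?thesis
  proof cases
    case (taut p \<sigma>)
    \<comment> \<open>The model induces a classical valuation: a variable counts as true when the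
      formula substituted for it has its value in \<open>TRUE M\<close>.\<close>
    have "interp M \<gamma> (inst \<sigma> p) \<in> TRUE M \<longleftrightarrow> truth_value (\<lambda>n. interp M \<gamma> (\<sigma> n) \<in> TRUE M) p"
      by (induction p) (simp_all add: T_simps)
    then show ?thesis using taut by (simp add: satisfies_def tautology_def)
  qed (auto simp: satisfies_def T_simps)
qed

lemma sci_sound:
  assumes "\<Phi> \<turnstile>\<^sub>S\<^sub>C\<^sub>I \<phi>"
  shows "sci_entails TYPE('m) \<Phi> \<phi>"
  unfolding sci_entails_def
proof (intro allI impI, elim conjE)
  fix M :: "'m sci_struct" and \<gamma>
  assume M: "is_sci_model M" and \<gamma>: "assignment M \<gamma>" and \<Phi>: "\<forall>\<psi>\<in>\<Phi>. satisfies M \<gamma> \<psi>"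
  interpret two_valued M "TRUE M"
    using M pre_ultrafilter_two_valued by (auto simp: is_sci_model_def)
  from assms show "satisfies M \<gamma> \<phi>"
  proof induction
    case (mp \<phi> \<psi>)
    then show ?case by (simp add: satisfies_def T_imp interp_in_univ[OF M \<gamma>])
  qed (use \<Phi> sci_axioms_sound[OF M \<gamma>] in auto)
qed

section \<open>Maximal consistent sets\<close>

lemma sci_derives_mono: "\<Phi> \<turnstile>\<^sub>S\<^sub>C\<^sub>I \<phi> \<Longrightarrow> \<Phi> \<subseteq> \<Psi> \<Longrightarrow> \<Psi> \<turnstile>\<^sub>S\<^sub>C\<^sub>I \<phi>"
  by (induction rule: sci_derives.induct) (auto intro: sci_derives.intros)

text \<open>Three schematic letters are provided; \<open>c\<close> is the value at index 2 and at
  every larger index.\<close>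

lemma tautology_instance:
  assumes "tautology p" "inst (\<lambda>n. if n = 0 then a else if n = 1 then b else c) p = q"
  shows "\<Phi> \<turnstile>\<^sub>S\<^sub>C\<^sub>I q"
  using assms sci_axioms.taut sci_derives.ax by blast

text \<open>The first three drive the deduction theorem, the fourth is proof by cases, and the
  others serve to describe maximal sets connective by connective.\<close>

lemma propositional_axioms:
  shows "\<Phi> \<turnstile>\<^sub>S\<^sub>C\<^sub>I Imp a a"
    and "\<Phi> \<turnstile>\<^sub>S\<^sub>C\<^sub>I Imp a (Imp b a)"
    and "\<Phi> \<turnstile>\<^sub>S\<^sub>C\<^sub>I Imp (Imp a (Imp b c)) (Imp (Imp a b) (Imp a c))"
    and "\<Phi> \<turnstile>\<^sub>S\<^sub>C\<^sub>I Imp (Imp a c) (Imp (Imp (Neg a) c) c)"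
    and "\<Phi> \<turnstile>\<^sub>S\<^sub>C\<^sub>I Imp (Neg a) (Imp a b)"
    and "\<Phi> \<turnstile>\<^sub>S\<^sub>C\<^sub>I Top"
    and "\<Phi> \<turnstile>\<^sub>S\<^sub>C\<^sub>I Imp Bot a"
    and "\<Phi> \<turnstile>\<^sub>S\<^sub>C\<^sub>I Imp a (Or a b)"
    and "\<Phi> \<turnstile>\<^sub>S\<^sub>C\<^sub>I Imp b (Or a b)"
    and "\<Phi> \<turnstile>\<^sub>S\<^sub>C\<^sub>I Imp (Or a b) (Imp (Neg a) b)"
    and "\<Phi> \<turnstile>\<^sub>S\<^sub>C\<^sub>I Imp (And a b) a"
    and "\<Phi> \<turnstile>\<^sub>S\<^sub>C\<^sub>I Imp (And a b) b"
    and "\<Phi> \<turnstile>\<^sub>S\<^sub>C\<^sub>I Imp a (Imp b (And a b))"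
proof -
  let ?A = "CVar 0" and ?B = "CVar 1" and ?C = "CVar 2"
  note t = tautology_instance[where a = a and b = b and c = c]
  show "\<Phi> \<turnstile>\<^sub>S\<^sub>C\<^sub>I Imp a a"
    by (rule t[of "CImp ?A ?A"]) (simp_all add: tautology_def)
  show "\<Phi> \<turnstile>\<^sub>S\<^sub>C\<^sub>I Imp a (Imp b a)"
    by (rule t[of "CImp ?A (CImp ?B ?A)"]) (simp_all add: tautology_def)
  show "\<Phi> \<turnstile>\<^sub>S\<^sub>C\<^sub>I Imp (Imp a (Imp b c)) (Imp (Imp a b) (Imp a c))"
    by (rule t[of "CImp (CImp ?A (CImp ?B ?C)) (CImp (CImp ?A ?B) (CImp ?A ?C))"])
      (simp_all add: tautology_def)
  show "\<Phi> \<turnstile>\<^sub>S\<^sub>C\<^sub>I Imp (Imp a c) (Imp (Imp (Neg a) c) c)"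
    by (rule t[of "CImp (CImp ?A ?C) (CImp (CImp (CNeg ?A) ?C) ?C)"])
      (auto simp: tautology_def)
  show "\<Phi> \<turnstile>\<^sub>S\<^sub>C\<^sub>I Imp (Neg a) (Imp a b)"
    by (rule t[of "CImp (CNeg ?A) (CImp ?A ?B)"]) (simp_all add: tautology_def)
  show "\<Phi> \<turnstile>\<^sub>S\<^sub>C\<^sub>I Top"
    by (rule t[of CTop]) (simp_all add: tautology_def)
  show "\<Phi> \<turnstile>\<^sub>S\<^sub>C\<^sub>I Imp Bot a"
    by (rule t[of "CImp CBot ?A"]) (simp_all add: tautology_def)
  show "\<Phi> \<turnstile>\<^sub>S\<^sub>C\<^sub>I Imp a (Or a b)"
    by (rule t[of "CImp ?A (COr ?A ?B)"]) (simp_all add: tautology_def)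
  show "\<Phi> \<turnstile>\<^sub>S\<^sub>C\<^sub>I Imp b (Or a b)"
    by (rule t[of "CImp ?B (COr ?A ?B)"]) (simp_all add: tautology_def)
  show "\<Phi> \<turnstile>\<^sub>S\<^sub>C\<^sub>I Imp (Or a b) (Imp (Neg a) b)"
    by (rule t[of "CImp (COr ?A ?B) (CImp (CNeg ?A) ?B)"]) (auto simp: tautology_def)
  show "\<Phi> \<turnstile>\<^sub>S\<^sub>C\<^sub>I Imp (And a b) a"
    by (rule t[of "CImp (CAnd ?A ?B) ?A"]) (simp_all add: tautology_def)
  show "\<Phi> \<turnstile>\<^sub>S\<^sub>C\<^sub>I Imp (And a b) b"
    by (rule t[of "CImp (CAnd ?A ?B) ?B"]) (simp_all add: tautology_def)
  show "\<Phi> \<turnstile>\<^sub>S\<^sub>C\<^sub>I Imp a (Imp b (And a b))"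
    by (rule t[of "CImp ?A (CImp ?B (CAnd ?A ?B))"]) (simp_all add: tautology_def)
qed

text \<open>Modus Ponens is the only rule, so induction on derivations needs only three schemes:
  \<open>Imp a a\<close> and weakening for hypotheses and axioms, distribution of implication for
  Modus Ponens.\<close>

lemma sci_deduction:
  assumes "insert a \<Phi> \<turnstile>\<^sub>S\<^sub>C\<^sub>I b"
  shows "\<Phi> \<turnstile>\<^sub>S\<^sub>C\<^sub>I Imp a b"
  using assms
proof induction
  case (hyp b)
  then show ?case
    by (metis insertE propositional_axioms(1,2) sci_derives.hyp sci_derives.mp)
next
  case (ax b)
  then show ?case by (metis propositional_axioms(2) sci_derives.ax sci_derives.mp)
next
  case (mp b c)
  then show ?case by (metis propositional_axioms(3) sci_derives.mp)
qed

text \<open>This stands in for the finiteness of derivations: at Modus Ponens the premises come from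
  two comparable members of the chain, and the larger one derives both. Nonemptiness supplies a
  member for the axioms.\<close>

lemma sci_derives_Union_chain:
  assumes "subset.chain S C" "C \<noteq> {}" "\<Union>C \<turnstile>\<^sub>S\<^sub>C\<^sub>I \<phi>"
  shows "\<exists>\<Gamma>\<in>C. \<Gamma> \<turnstile>\<^sub>S\<^sub>C\<^sub>I \<phi>"
  using assms(3)
proof induction
  case (hyp \<phi>)
  then show ?case by (auto intro: sci_derives.hyp)
next
  case (ax \<phi>)
  then show ?case using assms(2) by (auto intro: sci_derives.ax)
next
  case (mp \<phi> \<psi>)
  then obtain \<Gamma> \<Delta> where \<Gamma>: "\<Gamma> \<in> C" "\<Gamma> \<turnstile>\<^sub>S\<^sub>C\<^sub>I \<phi>" and \<Delta>: "\<Delta> \<in> C" "\<Delta> \<turnstile>\<^sub>S\<^sub>C\<^sub>I Imp \<phi> \<psi>" by blast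
  have "\<Gamma> \<subseteq> \<Delta> \<or> \<Delta> \<subseteq> \<Gamma>"
    using assms(1) \<Gamma>(1) \<Delta>(1) by (auto simp: subset.chain_def)
  then show ?case using \<Gamma> \<Delta> by (metis sci_derives.mp sci_derives_mono)
qed

text \<open>Maximality is relative to one underivable formula \<open>\<phi>\<close>, which takes
  over the role of falsum.\<close>

locale maximal_nonderiving =
  fixes \<Gamma> :: "fm set" and \<phi> :: fm
  assumes nonderiving: "\<not> \<Gamma> \<turnstile>\<^sub>S\<^sub>C\<^sub>I \<phi>"
    and maximal: "a \<notin> \<Gamma> \<Longrightarrow> insert a \<Gamma> \<turnstile>\<^sub>S\<^sub>C\<^sub>I \<phi>"

text \<open>Zorn's lemma for the supersets of \<open>\<Phi>\<close> that do not derive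
  \<open>\<phi>\<close>; the previous lemma keeps unions of chains among them.\<close>

lemma sci_lindenbaum:
  assumes "\<not> \<Phi> \<turnstile>\<^sub>S\<^sub>C\<^sub>I \<phi>"
  obtains \<Gamma> where "\<Phi> \<subseteq> \<Gamma>" "maximal_nonderiving \<Gamma> \<phi>"
proof -
  let ?S = "{\<Gamma>. \<Phi> \<subseteq> \<Gamma> \<and> \<not> \<Gamma> \<turnstile>\<^sub>S\<^sub>C\<^sub>I \<phi>}"
  have "\<exists>\<Gamma>\<in>?S. \<forall>X\<in>?S. \<Gamma> \<subseteq> X \<longrightarrow> X = \<Gamma>"
  proof (rule subset_Zorn_nonempty)
    show "?S \<noteq> {}" using assms by blast
    show "\<Union>C \<in> ?S" if C: "C \<noteq> {}" "subset.chain ?S C" for C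
    proof -
      have "C \<subseteq> ?S" using C(2) by (auto simp: subset.chain_def)
      then show ?thesis using sci_derives_Union_chain[OF C(2,1)] C(1) by blast
    qed
  qed
  then obtain \<Gamma> where \<Gamma>: "\<Phi> \<subseteq> \<Gamma>" "\<not> \<Gamma> \<turnstile>\<^sub>S\<^sub>C\<^sub>I \<phi>"
    and max: "\<forall>X\<in>?S. \<Gamma> \<subseteq> X \<longrightarrow> X = \<Gamma>" by blast
  have "maximal_nonderiving \<Gamma> \<phi>"
  proof
    show "insert a \<Gamma> \<turnstile>\<^sub>S\<^sub>C\<^sub>I \<phi>" if "a \<notin> \<Gamma>" for a
      using that max[rule_format, of "insert a \<Gamma>"] \<Gamma> by blast
  qed fact
  then show ?thesis using that \<Gamma> by blast
qed

section \<open>Membership in a maximal set, connective by connective\<close>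

context maximal_nonderiving
begin

text \<open>Adding a missing formula \<open>a\<close> yields \<open>\<phi>\<close>, so
  \<open>Imp a \<phi>\<close> is derivable. If \<open>a\<close> were derivable too,
  \<open>\<Gamma>\<close> would derive \<open>\<phi>\<close>.\<close>

lemma derives_iff_mem: "\<Gamma> \<turnstile>\<^sub>S\<^sub>C\<^sub>I a \<longleftrightarrow> a \<in> \<Gamma>"
  by (metis maximal nonderiving sci_deduction sci_derives.hyp sci_derives.mp)

lemma mem_mp: "Imp a b \<in> \<Gamma> \<Longrightarrow> a \<in> \<Gamma> \<Longrightarrow> b \<in> \<Gamma>"
  using derives_iff_mem sci_derives.mp by blast

lemma mem_axiom: "a \<in> sci_axioms \<Longrightarrow> a \<in> \<Gamma>"
  using derives_iff_mem sci_derives.ax by blast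

lemmas mem_prop = propositional_axioms[where \<Phi> = \<Gamma>, unfolded derives_iff_mem]

lemma mem_Bot: "Bot \<notin> \<Gamma>"
  using mem_mp mem_prop(7) nonderiving derives_iff_mem by blast

text \<open>If \<open>a\<close> and \<open>Neg a\<close> were both missing, each would imply
  \<open>\<phi>\<close>, and proof by cases would put \<open>\<phi>\<close> into
  \<open>\<Gamma>\<close>.\<close>

lemma mem_Neg: "Neg a \<in> \<Gamma> \<longleftrightarrow> a \<notin> \<Gamma>"
proof
  show "Neg a \<in> \<Gamma> \<Longrightarrow> a \<notin> \<Gamma>"
    using mem_mp mem_prop(5) mem_Bot by blast
  show "Neg a \<in> \<Gamma>" if "a \<notin> \<Gamma>"
  proof (rule ccontr)
    assume "Neg a \<notin> \<Gamma>"
    then have "Imp a \<phi> \<in> \<Gamma>" "Imp (Neg a) \<phi> \<in> \<Gamma>"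
      using that maximal sci_deduction derives_iff_mem by blast+
    then have "\<phi> \<in> \<Gamma>" using mem_mp mem_prop(4) by blast
    then show False using nonderiving derives_iff_mem by blast
  qed
qed

lemma mem_Or: "Or a b \<in> \<Gamma> \<longleftrightarrow> a \<in> \<Gamma> \<or> b \<in> \<Gamma>"
  using mem_mp mem_prop(8-10) mem_Neg by blast

lemma mem_And: "And a b \<in> \<Gamma> \<longleftrightarrow> a \<in> \<Gamma> \<and> b \<in> \<Gamma>"
  using mem_mp mem_prop(11-13) by blast

lemma mem_Imp: "Imp a b \<in> \<Gamma> \<longleftrightarrow> (a \<in> \<Gamma> \<longrightarrow> b \<in> \<Gamma>)"
  using mem_mp mem_prop(2,5) mem_Neg by blast

lemma mem_Ident_refl: "Ident a a \<in> \<Gamma>"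
  by (simp add: mem_axiom sci_axioms.ident_refl)

lemma mem_Ident_imp: "Ident a b \<in> \<Gamma> \<Longrightarrow> a \<in> \<Gamma> \<Longrightarrow> b \<in> \<Gamma>"
  by (meson mem_axiom mem_mp sci_axioms.ident_imp)

lemma mem_Ident_Neg: "Ident a b \<in> \<Gamma> \<Longrightarrow> Ident (Neg a) (Neg b) \<in> \<Gamma>"
  by (meson mem_axiom mem_mp sci_axioms.ident_Neg)

lemma mem_Ident_cong:
  "c \<in> {Or, And, Imp, Ident} \<Longrightarrow> Ident a a' \<in> \<Gamma> \<Longrightarrow> Ident b b' \<in> \<Gamma> \<Longrightarrow> Ident (c a b) (c a' b') \<in> \<Gamma>"
  by (meson mem_And mem_axiom mem_mp sci_axioms.ident_cong)

text \<open>
  Both properties come from the congruence axiom for \<open>\<equiv>\<close> itself: replace one side of the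
  identities \<open>a \<equiv> a\<close> and \<open>a \<equiv> b\<close>, respectively.
\<close>

lemma mem_Ident_sym: "Ident a b \<in> \<Gamma> \<Longrightarrow> Ident b a \<in> \<Gamma>"
  using mem_Ident_cong[of Ident a b a a] mem_Ident_imp mem_Ident_refl by blast

lemma mem_Ident_trans: "Ident a b \<in> \<Gamma> \<Longrightarrow> Ident b c \<in> \<Gamma> \<Longrightarrow> Ident a c \<in> \<Gamma>"
  using mem_Ident_cong[of Ident a a b c] mem_Ident_imp mem_Ident_refl by blast

end

section \<open>Completeness\<close>

instance fm :: countable
  by countable_datatype

section \<open>The canonical model\<close>

context maximal_nonderiving
begin

text \<open>\<open>g\<close> realises the quotient map inside \<open>'m\<close>: choose one formula
  from each class, number it, and inject the numbers into \<open>'m\<close>.\<close>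

lemma embed_classes:
  assumes "infinite (UNIV :: 'm set)"
  obtains g :: "fm \<Rightarrow> 'm" where "\<And>a b. g a = g b \<longleftrightarrow> Ident a b \<in> \<Gamma>"
proof -
  obtain h :: "nat \<Rightarrow> 'm" where h: "inj h"
    using infinite_countable_subset[OF assms] by blast
  define rep where "rep a = (SOME b. Ident a b \<in> \<Gamma>)" for a
  have rep: "Ident a (rep a) \<in> \<Gamma>" for a
    unfolding rep_def by (rule someI) (rule mem_Ident_refl)
  have "rep a = rep b" if "Ident a b \<in> \<Gamma>" for a b
  proof -
    \<comment> \<open>Both formulas then give \<open>SOME\<close> the same predicate, hence the same
      choice.\<close>
    have "Ident a c \<in> \<Gamma> \<longleftrightarrow> Ident b c \<in> \<Gamma>" for c
      using that mem_Ident_sym mem_Ident_trans by blast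
    then show ?thesis by (simp add: rep_def)
  qed
  then have "rep a = rep b \<longleftrightarrow> Ident a b \<in> \<Gamma>" for a b
    using rep mem_Ident_sym mem_Ident_trans by metis
  then have "h (to_nat (rep a)) = h (to_nat (rep b)) \<longleftrightarrow> Ident a b \<in> \<Gamma>" for a b
    using h by (simp add: inj_eq)
  then show ?thesis by (rule that)
qed

lemma canonical_model:
  assumes "infinite (UNIV :: 'm set)"
  obtains M :: "'m sci_struct" and \<gamma>
  where "is_sci_model M" "assignment M \<gamma>" "\<And>\<psi>. satisfies M \<gamma> \<psi> \<longleftrightarrow> \<psi> \<in> \<Gamma>"
proof -
  obtain g :: "fm \<Rightarrow> 'm" where g: "\<And>a b. g a = g b \<longleftrightarrow> Ident a b \<in> \<Gamma>"
    using embed_classes[OF assms] by blast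
  define T where "T = g ` \<Gamma>"
  \<comment> \<open>Operations act on preimages picked by \<open>inv g\<close>; the congruence
    axioms make the resulting class independent of the pick.\<close>
  define lift where "lift c x y = g (c (inv g x) (inv g y))" for c x y
  define M :: "'m sci_struct" where "M = \<lparr>
    univ = range g,
    f_or = lift Or,
    f_and = lift And,
    f_neg = (\<lambda>x. g (Neg (inv g x))),
    f_bot = g Bot,
    f_top = g Top,
    f_imp = lift Imp,
    below = {(x, y). x \<in> range g \<and> y \<in> range g \<and> (x \<in> T \<longrightarrow> y \<in> T)},
    TRUE = T,
    f_ident = lift Ident\<rparr>"
  have inv: "Ident (inv g (g a)) a \<in> \<Gamma>" for a
    using g f_inv_into_f[of "g a" g UNIV] by blast
  have lift: "lift c (g a) (g b) = g (c a b)" if "c \<in> {Or, And, Imp, Ident}" for c a b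
    unfolding lift_def g using mem_Ident_cong[OF that inv inv] .
  have neg: "g (Neg (inv g (g a))) = g (Neg a)" for a
    unfolding g using mem_Ident_Neg[OF inv] .
  \<comment> \<open>By the axiom \<open>ident_imp\<close>, \<open>\<Gamma>\<close> is a union of
    classes.\<close>
  have mem: "g a \<in> T \<longleftrightarrow> a \<in> \<Gamma>" for a
    unfolding T_def by (metis g image_iff mem_Ident_imp)
  have inv_mem: "inv g (g a) \<in> \<Gamma> \<longleftrightarrow> a \<in> \<Gamma>" for a
    using inv mem_Ident_imp mem_Ident_sym by blast
  have T_range: "T \<subseteq> range g" by (auto simp: T_def)
  have "two_valued M (T)"
    by unfold_locales
      (auto simp: M_def closed_ops_def lift neg mem inv_mem subsetD[OF T_range] mem_Bot mem_prop(6) mem_Neg mem_Or mem_And mem_Imp)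
  then have "is_boolean_prealgebra M" "is_pre_ultrafilter M (T)"
    by (rule two_valued_pre_ultrafilter; simp add: M_def)+
  \<comment> \<open>The condition on \<open>f_ident\<close> is the defining property of
    \<open>g\<close>: \<open>g (Ident a b) \<in> T\<close> iff
    \<open>Ident a b \<in> \<Gamma>\<close> iff \<open>g a = g b\<close>.\<close>
  then have model: "is_sci_model M"
    by (auto simp: is_sci_model_def M_def lift mem g)
  \<comment> \<open>Truth lemma: when variables denote their own classes, so do all
    formulas.\<close>
  have "interp M (\<lambda>n. g (Var n)) \<psi> = g \<psi>" for \<psi>
    by (induction \<psi>) (simp_all add: M_def lift neg)
  then have "satisfies M (\<lambda>n. g (Var n)) \<psi> \<longleftrightarrow> \<psi> \<in> \<Gamma>" for \<psi>
    by (simp add: satisfies_def mem M_def)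
  moreover have "assignment M (\<lambda>n. g (Var n))"
    by (simp add: assignment_def M_def)
  ultimately show ?thesis using that[OF model] by simp
qed

end

lemma sci_complete:
  assumes "infinite (UNIV :: 'm set)" "sci_entails TYPE('m) \<Phi> \<phi>"
  shows "\<Phi> \<turnstile>\<^sub>S\<^sub>C\<^sub>I \<phi>"
proof (rule ccontr)
  assume "\<not> \<Phi> \<turnstile>\<^sub>S\<^sub>C\<^sub>I \<phi>"
  then obtain \<Gamma> where "\<Phi> \<subseteq> \<Gamma>" and max: "maximal_nonderiving \<Gamma> \<phi>"
    by (rule sci_lindenbaum)
  interpret maximal_nonderiving \<Gamma> \<phi> by fact
  obtain M :: "'m sci_struct" and \<gamma>
    where "is_sci_model M" "assignment M \<gamma>" "\<And>\<psi>. satisfies M \<gamma> \<psi> \<longleftrightarrow> \<psi> \<in> \<Gamma>"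
    using canonical_model[OF assms(1)] by blast
  \<comment> \<open>The canonical model satisfies exactly \<open>\<Gamma>\<close>, hence all of
    \<open>\<Phi>\<close>, and entailment would make it satisfy \<open>\<phi>\<close>.\<close>
  then have "\<phi> \<in> \<Gamma>"
    using assms(2) \<open>\<Phi> \<subseteq> \<Gamma>\<close> unfolding sci_entails_def by blast
  then show False using nonderiving derives_iff_mem by blast
qed

theorem theorem3p10:
  fixes \<Phi> :: "fm set" and \<phi> :: fm
  assumes "infinite (UNIV :: 'm set)"
  shows "sci_entails TYPE('m) \<Phi> \<phi> \<longleftrightarrow> \<Phi> \<turnstile>\<^sub>S\<^sub>C\<^sub>I \<phi>"
  \<comment> \<open>Infinity of \<open>'m\<close> makes room for the canonical model in the
    completeness half.\<close>
  using sci_sound sci_complete[OF assms] by blast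

end
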